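(* Let $m\ge0$ and let $\phi$ be a real scalar field on Minkowski spacetime satisfying $(\Box+m^2)\phi=0$. For any timelike unit vector $u$, the 1-supermomentum density vector $$s^\alpha(u)=W^{\alpha\beta\gamma\delta}u_\beta u_\gamma u_\delta,$$ with $W^{\alpha\beta\gamma\delta}$ as defined in the context, is timelike or null: $$s^\alpha(u)\,s_\alpha(u)\ \ge\ 0 .$$
   Context: Setting: Minkowski spacetime $\mathbb{R}^4$ with Galilean coordinates and metric $g_{\alpha\beta}=\mathrm{diag}(1,-1,-1,-1)$, used to raise and lower indices; commas denote partial derivatives; $\Box=g^{\alpha\beta}\partial_\alpha\partial_\beta$. Round brackets denote symmetrization with weight one: $X^{(\alpha\beta)}=\frac12(X^{\alpha\beta}+X^{\beta\alpha})$. Timelike unit vector: $g_{\alpha\beta}u^\alpha u^\beta=1$. Define $$\tau^{\alpha\beta}=\phi^{,\alpha\lambda}{\phi^{,\beta}}_{\lambda}-m^2\phi^{,\alpha}\phi^{,\beta}-\tfrac12 K g^{\alpha\beta},\qquad K=\tfrac12\phi^{,\rho\sigma}\phi_{,\rho\sigma}-m^2\phi^{,\lambda}\phi_{,\lambda}+\tfrac12 m^4\phi^2,$$ $$W^{\alpha\beta\gamma\delta}=\tfrac13\left(\phi^{,\alpha\beta}\phi^{,\gamma\delta}+2\phi^{,\alpha(\gamma}\phi^{,\delta)\beta}\right)-\tfrac16\left(g^{\alpha\beta}\tau^{\gamma\delta}+g^{\gamma\delta}\tau^{\alpha\beta}+2g^{\alpha(\gamma}\tau^{\delta)\beta}+2g^{\beta(\gamma}\tau^{\delta)\alpha}\right).$$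 *)

theory Defs
  imports "HOL-Analysis.Analysis"
begin

text \<open>Spacetime is \<open>real^4\<close>. The elements of the index type \<open>4\<close> are 0, 1, 2, 3
  (in that type the numeral 4 equals 0); index 0 is the time direction.\<close>

text \<open>Galilean components of the metric. The inverse metric has the same components, so
  \<open>mink_g\<close> serves for both \<open>g_{ab}\<close> (lowering) and \<open>g^{ab}\<close> (raising).\<close>

definition mink_g :: "4 \<Rightarrow> 4 \<Rightarrow> real" where
  "mink_g \<alpha> \<beta> = (if \<alpha> \<noteq> \<beta> then 0 else if \<alpha> = 0 then 1 else - 1)"

definition lower :: "real^4 \<Rightarrow> real^4" where
  "lower v = (\<chi> \<alpha>. \<Sum>\<beta>\<in>UNIV. mink_g \<alpha> \<beta> * v $ \<beta>)"

definition mink_prod :: "real^4 \<Rightarrow> real^4 \<Rightarrow> real" where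
  "mink_prod v w = (\<Sum>\<alpha>\<in>UNIV. \<Sum>\<beta>\<in>UNIV. mink_g \<alpha> \<beta> * v $ \<alpha> * w $ \<beta>)"

definition timelike_unit :: "real^4 \<Rightarrow> bool" where
  "timelike_unit u \<longleftrightarrow> mink_prod u u = 1"

definition pd :: "4 \<Rightarrow> (real^4 \<Rightarrow> real) \<Rightarrow> real^4 \<Rightarrow> real" where
  "pd \<alpha> f x = deriv (\<lambda>t. f (x + t *\<^sub>R axis \<alpha> 1)) 0"

text \<open>The regularity of a classical solution of a second-order equation: \<open>f\<close> is twice
  continuously differentiable on all of spacetime.\<close>

definition C2_field :: "(real^4 \<Rightarrow> real) \<Rightarrow> bool" where
  "C2_field f \<longleftrightarrow>
     (\<forall>x. f differentiable at x) \<and>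
     (\<forall>\<alpha> x. pd \<alpha> f differentiable at x) \<and>
     (\<forall>\<alpha> \<beta>. continuous_on UNIV (pd \<beta> (pd \<alpha> f)))"

definition dalembertian :: "(real^4 \<Rightarrow> real) \<Rightarrow> real^4 \<Rightarrow> real" where
  "dalembertian f x = (\<Sum>\<alpha>\<in>UNIV. \<Sum>\<beta>\<in>UNIV. mink_g \<alpha> \<beta> * pd \<alpha> (pd \<beta> f) x)"

text \<open>Derivatives with index positions recorded by \<open>d\<close> (down) and \<open>u\<close> (up):
  \<open>D_u\<close> is \<open>\<phi>^{,a}\<close>, \<open>D_dd\<close> is \<open>\<phi>_{,ab}\<close>, \<open>D_ud\<close> is \<open>\<phi>^{,a}_b\<close>, \<open>D_uu\<close> is \<open>\<phi>^{,ab}\<close>.\<close>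

definition D_u :: "(real^4 \<Rightarrow> real) \<Rightarrow> real^4 \<Rightarrow> 4 \<Rightarrow> real" where
  "D_u \<phi> x \<alpha> = (\<Sum>\<kappa>\<in>UNIV. mink_g \<alpha> \<kappa> * pd \<kappa> \<phi> x)"

definition D_dd :: "(real^4 \<Rightarrow> real) \<Rightarrow> real^4 \<Rightarrow> 4 \<Rightarrow> 4 \<Rightarrow> real" where
  "D_dd \<phi> x \<alpha> \<beta> = pd \<beta> (pd \<alpha> \<phi>) x"

definition D_ud :: "(real^4 \<Rightarrow> real) \<Rightarrow> real^4 \<Rightarrow> 4 \<Rightarrow> 4 \<Rightarrow> real" where
  "D_ud \<phi> x \<alpha> \<beta> = (\<Sum>\<mu>\<in>UNIV. mink_g \<alpha> \<mu> * D_dd \<phi> x \<mu> \<beta>)"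

definition D_uu :: "(real^4 \<Rightarrow> real) \<Rightarrow> real^4 \<Rightarrow> 4 \<Rightarrow> 4 \<Rightarrow> real" where
  "D_uu \<phi> x \<alpha> \<beta> = (\<Sum>\<mu>\<in>UNIV. \<Sum>\<nu>\<in>UNIV. mink_g \<alpha> \<mu> * mink_g \<beta> \<nu> * D_dd \<phi> x \<mu> \<nu>)"

definition K_scalar :: "real \<Rightarrow> (real^4 \<Rightarrow> real) \<Rightarrow> real^4 \<Rightarrow> real" where
  "K_scalar m \<phi> x =
     1/2 * (\<Sum>\<rho>\<in>UNIV. \<Sum>\<sigma>\<in>UNIV. D_uu \<phi> x \<rho> \<sigma> * D_dd \<phi> x \<rho> \<sigma>)
     - m^2 * (\<Sum>\<kappa>\<in>UNIV. D_u \<phi> x \<kappa> * pd \<kappa> \<phi> x)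
     + 1/2 * m^4 * (\<phi> x)^2"

definition tau :: "real \<Rightarrow> (real^4 \<Rightarrow> real) \<Rightarrow> real^4 \<Rightarrow> 4 \<Rightarrow> 4 \<Rightarrow> real" where
  "tau m \<phi> x \<alpha> \<beta> =
     (\<Sum>\<kappa>\<in>UNIV. D_uu \<phi> x \<alpha> \<kappa> * D_ud \<phi> x \<beta> \<kappa>)
     - m^2 * D_u \<phi> x \<alpha> * D_u \<phi> x \<beta>
     - 1/2 * K_scalar m \<phi> x * mink_g \<alpha> \<beta>"

definition symz :: "(4 \<Rightarrow> 4 \<Rightarrow> real) \<Rightarrow> 4 \<Rightarrow> 4 \<Rightarrow> real" where
  "symz X \<alpha> \<beta> = 1/2 * (X \<alpha> \<beta> + X \<beta> \<alpha>)"

definition W :: "real \<Rightarrow> (real^4 \<Rightarrow> real) \<Rightarrow> real^4 \<Rightarrow> 4 \<Rightarrow> 4 \<Rightarrow> 4 \<Rightarrow> 4 \<Rightarrow> real" where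
  "W m \<phi> x \<alpha> \<beta> \<gamma> \<delta> =
     1/3 * (D_uu \<phi> x \<alpha> \<beta> * D_uu \<phi> x \<gamma> \<delta>
            + 2 * symz (\<lambda>c d. D_uu \<phi> x \<alpha> c * D_uu \<phi> x d \<beta>) \<gamma> \<delta>)
     - 1/6 * (mink_g \<alpha> \<beta> * tau m \<phi> x \<gamma> \<delta> + mink_g \<gamma> \<delta> * tau m \<phi> x \<alpha> \<beta>
              + 2 * symz (\<lambda>c d. mink_g \<alpha> c * tau m \<phi> x d \<beta>) \<gamma> \<delta>
              + 2 * symz (\<lambda>c d. mink_g \<beta> c * tau m \<phi> x d \<alpha>) \<gamma> \<delta>)"

definition supermomentum :: "real \<Rightarrow> (real^4 \<Rightarrow> real) \<Rightarrow> real^4 \<Rightarrow> real^4 \<Rightarrow> real^4" where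
  "supermomentum m \<phi> x u =
     (\<chi> \<alpha>. \<Sum>\<beta>\<in>UNIV. \<Sum>\<gamma>\<in>UNIV. \<Sum>\<delta>\<in>UNIV.
        W m \<phi> x \<alpha> \<beta> \<gamma> \<delta> * lower u $ \<beta> * lower u $ \<gamma> * lower u $ \<delta>)"

end

theory Submission
  imports Defs
begin

text \<open>The claim is pointwise and algebraic in the Hessian \<open>H\<close>, the gradient \<open>p\<close> and the value of
  \<open>\<phi>\<close>. Contracting \<open>W\<close> gives \<open>s = (v \<bullet> H v) H v - (\<tau>(v,v) u + \<tau> v) / 2\<close> with
  \<open>v = lower u\<close>. A Lorentz reflection takes \<open>v\<close> to plus or minus the time axis, and there, writing
  \<open>H\<close> in blocks with entries \<open>a\<close>, \<open>b\<close>, \<open>C\<close> and \<open>p = (p\<^sub>0, \<pi>)\<close>, up to a common sign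
  the time component of \<open>s\<close> is
  \<open>(a\<^sup>2 + 2 |b|\<^sup>2 + |C|\<^sup>2 + 2 m\<^sup>2 p\<^sub>0\<^sup>2 + 2 m\<^sup>2 |\<pi>|\<^sup>2 + m^4 \<phi>\<^sup>2) / 4\<close>, while its spatial part is
  \<open>(a b + C b + m\<^sup>2 p\<^sub>0 \<pi>) / 2\<close>. The triangle inequality, \<open>|C b| \<le> |C| |b|\<close> (Frobenius norm)
  and AM-GM bound the second by the first.\<close>

section \<open>Symmetry of second partial derivatives\<close>

text \<open>\<open>pd\<close> is a \<open>deriv\<close> at parameter 0, which is a genuine
  derivative only because f is differentiable. Shifting the base point along the axis extends this
  to every parameter t, as the mean value theorem requires.\<close>

lemma has_real_derivative_pd:
  assumes "\<And>y. f differentiable at y"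
  shows "((\<lambda>t. f (z + t *\<^sub>R axis \<alpha> 1)) has_real_derivative pd \<alpha> f (z + t *\<^sub>R axis \<alpha> 1)) (at t)"
proof -
  have "(\<lambda>s. f (z + t *\<^sub>R axis \<alpha> 1 + s *\<^sub>R axis \<alpha> 1)) differentiable at 0"
  proof (rule differentiable_compose[where f = f])
    show "f differentiable at (z + t *\<^sub>R axis \<alpha> 1 + 0 *\<^sub>R axis \<alpha> 1)" by (rule assms)
    show "(\<lambda>s. z + t *\<^sub>R axis \<alpha> 1 + s *\<^sub>R axis \<alpha> 1) differentiable at 0"
      by (intro derivative_intros differentiable_add differentiable_scaleR)
  qed
  then have "((\<lambda>s. f (z + t *\<^sub>R axis \<alpha> 1 + s *\<^sub>R axis \<alpha> 1))
      has_real_derivative pd \<alpha> f (z + t *\<^sub>R axis \<alpha> 1)) (at 0)"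
    unfolding pd_def by (metis DERIV_imp_deriv real_differentiable_def)
  then have "((\<lambda>s. f (z + (s + t) *\<^sub>R axis \<alpha> 1))
      has_real_derivative pd \<alpha> f (z + t *\<^sub>R axis \<alpha> 1)) (at 0)"
    by (simp add: algebra_simps)
  then show ?thesis
    using DERIV_shift[of "\<lambda>s. f (z + s *\<^sub>R axis \<alpha> 1)" _ 0 t] by simp
qed

text \<open>The mean value theorem is applied twice: along the first axis to the difference of f on
  two parallel lines a distance h apart, then along the second axis to
  \<open>pd \<alpha> f\<close>.\<close>

lemma second_difference_eq_pd_pd:
  assumes f: "\<And>y. f differentiable at y" and pf: "\<And>y. pd \<alpha> f differentiable at y" and "h > 0"
  obtains s t where "0 < s" "s < h" "0 < t" "t < h"
    "f (z + h *\<^sub>R axis \<alpha> 1 + h *\<^sub>R axis \<beta> 1) - f (z + h *\<^sub>R axis \<alpha> 1)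
      - (f (z + h *\<^sub>R axis \<beta> 1) - f z)
     = h\<^sup>2 * pd \<beta> (pd \<alpha> f) (z + s *\<^sub>R axis \<alpha> 1 + t *\<^sub>R axis \<beta> 1)"
proof -
  let ?a = "axis \<alpha> 1 :: real^4" and ?b = "axis \<beta> 1 :: real^4"
  have "((\<lambda>s. f (z + h *\<^sub>R ?b + s *\<^sub>R ?a) - f (z + s *\<^sub>R ?a)) has_real_derivative
      pd \<alpha> f (z + h *\<^sub>R ?b + s *\<^sub>R ?a) - pd \<alpha> f (z + s *\<^sub>R ?a)) (at s)" for s
    by (intro DERIV_diff has_real_derivative_pd f)
  from MVT2[OF \<open>h > 0\<close> this] obtain s where s: "0 < s" "s < h"
    and eq1: "f (z + h *\<^sub>R ?b + h *\<^sub>R ?a) - f (z + h *\<^sub>R ?a) - (f (z + h *\<^sub>R ?b) - f z)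
      = h * (pd \<alpha> f (z + h *\<^sub>R ?b + s *\<^sub>R ?a) - pd \<alpha> f (z + s *\<^sub>R ?a))"
    by auto
  have "((\<lambda>t. pd \<alpha> f (z + s *\<^sub>R ?a + t *\<^sub>R ?b)) has_real_derivative
      pd \<beta> (pd \<alpha> f) (z + s *\<^sub>R ?a + t *\<^sub>R ?b)) (at t)" for t
    by (intro has_real_derivative_pd pf)
  from MVT2[OF \<open>h > 0\<close> this] obtain t where t: "0 < t" "t < h"
    and eq2: "pd \<alpha> f (z + s *\<^sub>R ?a + h *\<^sub>R ?b) - pd \<alpha> f (z + s *\<^sub>R ?a)
      = h * pd \<beta> (pd \<alpha> f) (z + s *\<^sub>R ?a + t *\<^sub>R ?b)"
    by auto
  show thesis
    by (rule that[OF s t]) (use eq1 eq2 in \<open>simp add: power2_eq_square add.assoc add.commute add.left_commute\<close>)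
qed

text \<open>The second difference over a square does not depend on the order of the two axes. Hence
  the two mixed derivatives agree at some pair of points near z, and continuity carries the equality
  to z.\<close>

lemma pd_commute:
  assumes "C2_field f"
  shows "pd \<beta> (pd \<alpha> f) z = pd \<alpha> (pd \<beta> f) z"
proof -
  let ?a = "axis \<alpha> 1 :: real^4" and ?b = "axis \<beta> 1 :: real^4"
  have f: "\<And>y. f differentiable at y" and pf: "\<And>\<alpha> y. pd \<alpha> f differentiable at y"
    and cont: "\<And>\<alpha> \<beta>. isCont (pd \<beta> (pd \<alpha> f)) z"
    using assms by (auto simp: C2_field_def continuous_on_eq_continuous_at)
  have "\<bar>pd \<beta> (pd \<alpha> f) z - pd \<alpha> (pd \<beta> f) z\<bar> \<le> e" if "e > 0" for e
  proof -
    have "e / 2 > 0" using that by simp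
    then obtain d1 d2 where d: "d1 > 0" "d2 > 0"
      and d1: "\<And>y. dist y z < d1 \<Longrightarrow> dist (pd \<beta> (pd \<alpha> f) y) (pd \<beta> (pd \<alpha> f) z) < e / 2"
      and d2: "\<And>y. dist y z < d2 \<Longrightarrow> dist (pd \<alpha> (pd \<beta> f) y) (pd \<alpha> (pd \<beta> f) z) < e / 2"
      using cont unfolding continuous_at_eps_delta by meson
    \<comment> \<open>Both parameters stay below h, so the two axis steps together have length below
      2 h, which is \<open>min d1 d2\<close>.\<close>
    define h where "h = min d1 d2 / 2"
    have "h > 0" using d by (simp add: h_def)
    have near: "dist (z + s *\<^sub>R axis i 1 + t *\<^sub>R axis j 1) z < min d1 d2"
      if "0 < s" "s < h" "0 < t" "t < h" for s t i j
    proof -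
      have "norm (s *\<^sub>R axis i 1 + t *\<^sub>R axis j 1 :: real^4) \<le> s + t"
        using that by (intro norm_triangle_le) simp
      also have "\<dots> < min d1 d2" using that by (simp add: h_def)
      finally show ?thesis by (simp add: dist_norm add.assoc)
    qed
    from second_difference_eq_pd_pd[OF f pf \<open>h > 0\<close>, where z = z and \<alpha> = \<alpha> and \<beta> = \<beta>] obtain s t
      where st: "0 < s" "s < h" "0 < t" "t < h" and
      eq1: "f (z + h *\<^sub>R ?a + h *\<^sub>R ?b) - f (z + h *\<^sub>R ?a) - (f (z + h *\<^sub>R ?b) - f z)
       = h\<^sup>2 * pd \<beta> (pd \<alpha> f) (z + s *\<^sub>R ?a + t *\<^sub>R ?b)" .
    from second_difference_eq_pd_pd[OF f pf \<open>h > 0\<close>, where z = z and \<alpha> = \<beta> and \<beta> = \<alpha>] obtain s' t'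
      where st': "0 < s'" "s' < h" "0 < t'" "t' < h" and
      eq2: "f (z + h *\<^sub>R ?b + h *\<^sub>R ?a) - f (z + h *\<^sub>R ?b) - (f (z + h *\<^sub>R ?a) - f z)
       = h\<^sup>2 * pd \<alpha> (pd \<beta> f) (z + s' *\<^sub>R ?b + t' *\<^sub>R ?a)" .
    have "z + h *\<^sub>R ?a + h *\<^sub>R ?b = z + h *\<^sub>R ?b + h *\<^sub>R ?a" by (simp add: algebra_simps)
    with eq1 eq2 \<open>h > 0\<close> have "pd \<beta> (pd \<alpha> f) (z + s *\<^sub>R ?a + t *\<^sub>R ?b)
        = pd \<alpha> (pd \<beta> f) (z + s' *\<^sub>R ?b + t' *\<^sub>R ?a)"
      by (smt (verit) mult_left_cancel zero_less_power)
    moreover have "dist (pd \<beta> (pd \<alpha> f) (z + s *\<^sub>R ?a + t *\<^sub>R ?b)) (pd \<beta> (pd \<alpha> f) z) < e / 2"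
      using near[OF st] by (intro d1) simp
    moreover have "dist (pd \<alpha> (pd \<beta> f) (z + s' *\<^sub>R ?b + t' *\<^sub>R ?a)) (pd \<alpha> (pd \<beta> f) z) < e / 2"
      using near[OF st'] by (intro d2) simp
    ultimately show ?thesis unfolding dist_real_def by linarith
  qed
  then have "\<bar>pd \<beta> (pd \<alpha> f) z - pd \<alpha> (pd \<beta> f) z\<bar> \<le> 0"
    by (rule field_le_epsilon) simp
  then show ?thesis by simp
qed

section \<open>The metric as a matrix, and the tensors in matrix form\<close>

definition mink_mat :: "real^4^4" where
  "mink_mat = (\<chi> \<alpha> \<beta>. mink_g \<alpha> \<beta>)"

lemma mink_g_commute: "mink_g \<alpha> \<beta> = mink_g \<beta> \<alpha>"
  by (simp add: mink_g_def)

lemma mink_mat_mult_vector_nth: "(mink_mat *v v) $ \<alpha> = mink_g \<alpha> \<alpha> * v $ \<alpha>"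
proof -
  have "(mink_mat *v v) $ \<alpha> = (\<Sum>\<beta>\<in>UNIV. mink_g \<alpha> \<beta> * v $ \<beta>)"
    by (simp add: mink_mat_def matrix_vector_mult_def)
  also have "\<dots> = (\<Sum>\<beta>\<in>UNIV. if \<beta> = \<alpha> then mink_g \<alpha> \<alpha> * v $ \<alpha> else 0)"
    by (rule sum.cong) (auto simp: mink_g_def)
  finally show ?thesis by simp
qed

lemma lower_eq_mink_mat: "lower v = mink_mat *v v"
  by (simp add: lower_def mink_mat_def matrix_vector_mult_def)

lemma mink_prod_eq_inner: "mink_prod v w = v \<bullet> (mink_mat *v w)"
  by (simp add: mink_prod_def inner_vec_def mink_mat_def matrix_vector_mult_def
      sum_distrib_left mult_ac)

lemma mink_mat_involution: "mink_mat *v (mink_mat *v v) = v"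
  by (simp add: vec_eq_iff mink_mat_mult_vector_nth mink_g_def)

lemma mink_mat_self_adjoint: "(mink_mat *v v) \<bullet> w = v \<bullet> (mink_mat *v w)"
  by (simp add: inner_vec_def mink_mat_mult_vector_nth mult_ac)

text \<open>In the following algebraic versions, \<open>H\<close> and \<open>p\<close> are the second and first derivatives with
  upper indices, \<open>v\<close> is a covector, and \<open>q\<close>, \<open>c\<close> stand for \<open>m\<^sup>2\<close> and \<open>m^4 \<phi>\<^sup>2 / 2\<close>;
  \<open>tau_alg\<close> and \<open>s_alg\<close> are already contracted with \<open>v\<close>.\<close>

definition K_alg :: "real \<Rightarrow> real \<Rightarrow> real^4^4 \<Rightarrow> real^4 \<Rightarrow> real" where
  "K_alg q c H p = 1/2 * trace (H ** mink_mat ** transpose H ** mink_mat) - q * (p \<bullet> (mink_mat *v p)) + c"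

definition tau_alg :: "real \<Rightarrow> real \<Rightarrow> real^4^4 \<Rightarrow> real^4 \<Rightarrow> real^4 \<Rightarrow> real^4" where
  "tau_alg q c H p v = H *v (mink_mat *v (transpose H *v v)) - (q * (p \<bullet> v)) *\<^sub>R p
     - (1/2 * K_alg q c H p) *\<^sub>R (mink_mat *v v)"

definition s_alg :: "real \<Rightarrow> real \<Rightarrow> real^4^4 \<Rightarrow> real^4 \<Rightarrow> real^4 \<Rightarrow> real^4" where
  "s_alg q c H p v = (v \<bullet> (H *v v)) *\<^sub>R (H *v v)
     - (1/2) *\<^sub>R ((v \<bullet> tau_alg q c H p v) *\<^sub>R (mink_mat *v v) + tau_alg q c H p v)"

section \<open>Lorentz covariance\<close>

lemma inner_transpose: "(transpose A *v x) \<bullet> y = x \<bullet> (A *v y)" for A :: "real^'n^'m"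
  by (simp add: dot_lmul_matrix)

text \<open>Upper indices transform with L, and the covector v is pulled back by
  \<open>transpose L\<close>. Every contraction of two indices of the same kind passes through the
  metric, where one of the two assumptions makes L cancel: one serves the metric with upper indices,
  the other the metric with lower indices.\<close>

lemma
  fixes L :: "real^4^4"
  assumes L: "L ** mink_mat ** transpose L = mink_mat" "transpose L ** mink_mat ** L = mink_mat"
  shows K_alg_Lorentz: "K_alg q c (L ** H ** transpose L) (L *v p) = K_alg q c H p"
    and tau_alg_Lorentz: "tau_alg q c (L ** H ** transpose L) (L *v p) v
      = L *v tau_alg q c H p (transpose L *v v)"
    and s_alg_Lorentz: "s_alg q c (L ** H ** transpose L) (L *v p) v
      = L *v s_alg q c H p (transpose L *v v)"
proof -
  have L1: "L *v (mink_mat *v (transpose L *v x)) = mink_mat *v x" for x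
    by (simp only: matrix_vector_mul_assoc matrix_mul_assoc L)
  have L2: "transpose L *v (mink_mat *v (L *v x)) = mink_mat *v x" for x
    by (simp only: matrix_vector_mul_assoc matrix_mul_assoc L)
  have "trace (L ** H ** transpose L ** mink_mat ** transpose (L ** H ** transpose L) ** mink_mat)
      = trace (L ** (H ** (transpose L ** mink_mat ** L) ** transpose H ** transpose L ** mink_mat))"
    by (simp only: matrix_transpose_mul transpose_transpose matrix_mul_assoc)
  \<comment> \<open>Cyclicity of the trace moves the outermost L to the end, so that both metrics
    stand between \<open>transpose L\<close> and L.\<close>
  also have "\<dots> = trace (H ** (transpose L ** mink_mat ** L) ** transpose H ** (transpose L ** mink_mat ** L))"
    by (subst trace_mul_sym) (simp only: matrix_mul_assoc)
  finally have tr: "trace (L ** H ** transpose L ** mink_mat ** transpose (L ** H ** transpose L) ** mink_mat)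
      = trace (H ** mink_mat ** transpose H ** mink_mat)"
    unfolding L(2) .
  have dot1: "(L *v y) \<bullet> x = y \<bullet> (transpose L *v x)" for x y
    using inner_transpose[of "transpose L" y x] by (simp only: transpose_transpose)
  have dot2: "x \<bullet> (L *v y) = (transpose L *v x) \<bullet> y" for x y
    by (rule inner_transpose[symmetric])
  show K: "K_alg q c (L ** H ** transpose L) (L *v p) = K_alg q c H p"
    unfolding K_alg_def tr by (simp only: dot1 L2)
  show T: "tau_alg q c (L ** H ** transpose L) (L *v p) v
      = L *v tau_alg q c H p (transpose L *v v)" for v
    unfolding tau_alg_def K matrix_vector_mult_diff_distrib matrix_vector_mult_scaleR L1
    by (simp only: matrix_transpose_mul transpose_transpose L2 dot1 flip: matrix_vector_mul_assoc)
  show "s_alg q c (L ** H ** transpose L) (L *v p) v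
      = L *v s_alg q c H p (transpose L *v v)"
    unfolding s_alg_def T matrix_vector_mult_diff_distrib matrix_vector_right_distrib
      matrix_vector_mult_scaleR L1
    by (simp only: dot2 flip: matrix_vector_mul_assoc)
qed

lemma rank_one_perturbation_mult_vector:
  fixes a b x :: "real^'n"
  shows "(\<chi> i j. (if i = j then 1 else 0) - k * a $ i * b $ j) *v x = x - (k * (b \<bullet> x)) *\<^sub>R a"
    (is "?M *v x = _")
proof (rule vec_eq_iff[THEN iffD2], rule)
  fix i
  have "(?M *v x) $ i = (\<Sum>j\<in>UNIV. (if i = j then x $ j else 0) - (k * a $ i) * (b $ j * x $ j))"
    unfolding matrix_vector_mult_def by (simp, rule sum.cong) (auto simp: algebra_simps)
  also have "\<dots> = x $ i - (k * a $ i) * (b \<bullet> x)"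
    by (simp add: sum_subtractf inner_vec_def flip: sum_distrib_left)
  finally show "(?M *v x) $ i = (x - (k * (b \<bullet> x)) *\<^sub>R a) $ i"
    by simp
qed

text \<open>M is the reflection that negates \<open>mink_mat *v n\<close> and fixes the vectors
  annihilated by n; the assumption excludes null n and fixes k. Moving the metric past M turns M
  into its transpose, so M being an involution already makes it preserve the metric.\<close>

lemma Lorentz_reflection:
  fixes n v :: "real^4" and k :: real
  assumes k: "k * (n \<bullet> (mink_mat *v n)) = 2"
  defines "M \<equiv> (\<chi> i j. (if i = j then 1 else 0) - k * (mink_mat *v n) $ i * n $ j) :: real^4^4"
  shows "M *v v = v - (k * (n \<bullet> v)) *\<^sub>R (mink_mat *v n)"
    and "M *v (M *v v) = v"
    and "M ** mink_mat ** transpose M = mink_mat"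
    and "transpose M ** mink_mat ** M = mink_mat"
proof -
  have M: "M *v x = x - (k * (n \<bullet> x)) *\<^sub>R (mink_mat *v n)" for x
    unfolding M_def by (rule rank_one_perturbation_mult_vector)
  have "transpose M = (\<chi> i j. (if i = j then 1 else 0) - k * n $ i * (mink_mat *v n) $ j)"
    by (simp add: M_def transpose_def vec_eq_iff)
  then have MT: "transpose M *v x = x - (k * ((mink_mat *v n) \<bullet> x)) *\<^sub>R n" for x
    by (simp only: rank_one_perturbation_mult_vector)
  show "M *v v = v - (k * (n \<bullet> v)) *\<^sub>R (mink_mat *v n)" by (rule M)
  have k': "k * (k * (n \<bullet> (mink_mat *v n)) * t) = 2 * k * t" for t
    using k by simp
  have inv: "M *v (M *v x) = x" for x
  proof -
    have "k * (n \<bullet> (x - (k * (n \<bullet> x)) *\<^sub>R (mink_mat *v n))) = - (k * (n \<bullet> x))"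
      using k'[of "n \<bullet> x"] by (simp add: inner_diff_right algebra_simps)
    then show ?thesis by (simp only: M) simp
  qed
  then show "M *v (M *v v) = v" .
  have comm: "M *v (mink_mat *v x) = mink_mat *v (transpose M *v x)" for x
    by (simp only: M MT matrix_vector_mult_diff_distrib matrix_vector_mult_scaleR mink_mat_self_adjoint)
  have "M *v (mink_mat *v (transpose M *v x)) = mink_mat *v x" for x
    by (simp only: comm[symmetric] inv)
  then show "M ** mink_mat ** transpose M = mink_mat"
    by (simp only: matrix_eq flip: matrix_vector_mul_assoc) simp
  \<comment> \<open>Conjugation by the metric carries M to its transpose, so the second identity
    again reduces to the involution.\<close>
  have "transpose M *v y = mink_mat *v (M *v (mink_mat *v y))" for y
    by (simp only: comm mink_mat_involution)
  then have "transpose M *v (mink_mat *v (M *v x)) = mink_mat *v x" for x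
    by (simp only: mink_mat_involution inv)
  then show "transpose M ** mink_mat ** M = mink_mat"
    by (simp only: matrix_eq flip: matrix_vector_mul_assoc) simp
qed

section \<open>The estimate in the rest frame\<close>

lemma sum_4_split: "(\<Sum>i\<in>UNIV. f i) = f 0 + (\<Sum>i\<in>-{0::4}. f i)" for f :: "4 \<Rightarrow> 'a::comm_monoid_add"
  using sum.remove[of UNIV "0::4" f] by (simp add: Compl_eq_Diff_UNIV)

lemma matrix_mult_mink_mat_nth: "(A ** mink_mat) $ i $ j = A $ i $ j * mink_g j j"
proof -
  have "(A ** mink_mat) $ i $ j = (\<Sum>k\<in>UNIV. A $ i $ k * mink_g k j)"
    by (simp add: matrix_matrix_mult_def mink_mat_def)
  also have "\<dots> = (\<Sum>k\<in>UNIV. if k = j then A $ i $ j * mink_g j j else 0)"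
    by (rule sum.cong) (auto simp: mink_g_def)
  finally show ?thesis by simp
qed

lemma trace_Minkowski_square:
  "trace (H ** mink_mat ** transpose H ** mink_mat)
   = (\<Sum>i\<in>UNIV. \<Sum>j\<in>UNIV. mink_g i i * mink_g j j * (H $ i $ j)\<^sup>2)"
proof -
  have "(H ** mink_mat ** transpose H ** mink_mat) $ i $ i
      = (\<Sum>j\<in>UNIV. mink_g i i * mink_g j j * (H $ i $ j)\<^sup>2)" for i
    unfolding matrix_mult_mink_mat_nth
    by (simp add: matrix_matrix_mult_def[of "H ** mink_mat"] matrix_mult_mink_mat_nth
        transpose_def sum_distrib_left power2_eq_square mult_ac)
  then show ?thesis by (simp add: trace_def)
qed

text \<open>Cauchy-Schwarz in each row: the Frobenius norm bounds the operator norm.\<close>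

lemma L2_set_matrix_vector_le:
  "L2_set (\<lambda>i. \<Sum>j\<in>J. C i j * b j) I \<le> sqrt (\<Sum>i\<in>I. \<Sum>j\<in>J. (C i j)\<^sup>2) * L2_set b J"
proof -
  have "(\<Sum>i\<in>I. (\<Sum>j\<in>J. C i j * b j)\<^sup>2) \<le> (\<Sum>i\<in>I. (\<Sum>j\<in>J. (C i j)\<^sup>2) * (\<Sum>j\<in>J. (b j)\<^sup>2))"
    by (intro sum_mono Cauchy_Schwarz_ineq_sum)
  then show ?thesis
    by (simp add: L2_set_def sum_distrib_right flip: real_sqrt_mult)
qed

lemma L2_set_mult_left: "L2_set (\<lambda>i. r * f i) I = \<bar>r\<bar> * L2_set f I"
  by (simp add: L2_set_def power_mult_distrib real_sqrt_mult flip: sum_distrib_left)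

text \<open>The factor \<open>\<sigma>\<close> is a sign: the reflection used later may bring v to
  either direction of the time axis. It factors out of all components of s and disappears on
  squaring.\<close>

lemma s_alg_rest_frame:
  fixes p :: "real^4"
  assumes "q \<ge> 0" "c \<ge> 0" and sym: "transpose H = H" and \<sigma>: "\<sigma>\<^sup>2 = 1"
  defines "s \<equiv> s_alg q c H p (axis 0 \<sigma>)"
  shows "s \<bullet> (mink_mat *v s) \<ge> 0"
proof -
  let ?I = "- {0::4}"
  define a where "a = H $ 0 $ 0"
  \<comment> \<open>This is the whole time column, so \<open>b 0\<close> is a; the off-diagonal
    block is its restriction to \<open>?I\<close>.\<close>
  define b where "b i = H $ i $ 0" for i
  define B where "B = (\<Sum>i\<in>?I. (b i)\<^sup>2)"
  define F where "F = (\<Sum>i\<in>?I. \<Sum>j\<in>?I. (H $ i $ j)\<^sup>2)"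
  define P where "P = (\<Sum>i\<in>?I. (p $ i)\<^sup>2)"
  define p0 where "p0 = p $ 0"
  define K where "K = K_alg q c H p"
  define T where "T = tau_alg q c H p (axis 0 \<sigma>)"
  define Cb where "Cb i = (\<Sum>j\<in>?I. H $ i $ j * b j)" for i
  have Hsym: "H $ i $ j = H $ j $ i" for i j
    proof -
    have "transpose H $ j $ i = H $ i $ j" by (simp add: transpose_def)
    then show ?thesis by (simp add: sym)
  qed
  have g: "mink_g 0 0 = 1" "\<And>i. i \<in> ?I \<Longrightarrow> mink_g i i = -1"
    by (auto simp: mink_g_def)
  have ss: "\<sigma> * \<sigma> = 1" "\<And>t. \<sigma> * (\<sigma> * t) = t"
    using \<sigma> by (simp_all add: power2_eq_square flip: mult.assoc)
  have Hv: "(H *v axis 0 \<sigma>) $ i = \<sigma> * b i" for i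
    by (simp add: matrix_vector_mult_def axis_def b_def if_distrib mult.commute cong: if_cong)
  have inner_ax: "axis 0 \<sigma> \<bullet> y = \<sigma> * y $ 0" "y \<bullet> axis 0 \<sigma> = \<sigma> * y $ 0" for y :: "real^4"
    by (simp_all add: inner_axis inner_axis' mult.commute)
  \<comment> \<open>The time entry of the column contributes \<open>b i * a\<close>; the spatial
    entries acquire the minus sign of the metric and give \<open>- Cb i\<close>.\<close>
  have HHv: "(H *v (mink_mat *v (H *v axis 0 \<sigma>))) $ i = \<sigma> * (b i * a - Cb i)" for i
    by (simp add: matrix_vector_mult_def[of H "mink_mat *v _"] mink_mat_mult_vector_nth Hv sum_4_split g
        Cb_def a_def b_def sum_distrib_left sum_negf algebra_simps cong: sum.cong_simp)
  have T: "T $ i = \<sigma> * (b i * a - Cb i - q * p0 * p $ i) - K / 2 * (mink_g i i * axis 0 \<sigma> $ i)" for i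
    by (simp add: T_def tau_alg_def sym HHv inner_ax mink_mat_mult_vector_nth K_def p0_def algebra_simps
        del: transpose_matrix_vector)
  have Cb0: "Cb 0 = B"
    by (simp add: Cb_def B_def b_def power2_eq_square Hsym[of 0])
  have "(\<Sum>i\<in>?I. (H $ 0 $ i)\<^sup>2) = B"
    by (simp add: B_def b_def Hsym[of 0])
  then have "trace (H ** mink_mat ** transpose H ** mink_mat) = a\<^sup>2 - 2 * B + F"
    by (simp add: trace_Minkowski_square sum_4_split g F_def a_def B_def b_def sum_negf sum.distrib
        sum_subtractf cong: sum.cong_simp)
  moreover have "p \<bullet> (mink_mat *v p) = p0\<^sup>2 - P"
    by (simp add: inner_vec_def mink_mat_mult_vector_nth sum_4_split g P_def p0_def sum_negf
        power2_eq_square cong: sum.cong_simp)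
  ultimately have K: "K = (a\<^sup>2 - 2 * B + F) / 2 - q * (p0\<^sup>2 - P) + c"
    by (simp add: K_def K_alg_def)
  \<comment> \<open>S is \<open>B + q * p0\<^sup>2 + K / 2\<close> written out. The two added terms
    outweigh the negative ones in \<open>K / 2\<close>, which leaves a sum of nonnegative
    terms.\<close>
  define S where "S = (a\<^sup>2 + 2 * B + F) / 4 + q * (p0\<^sup>2 + P) / 2 + c / 2"
  have T0: "T $ 0 = \<sigma> * (a\<^sup>2 - B - q * p0\<^sup>2 - K / 2)"
    by (simp add: T Cb0 g axis_def b_def p0_def flip: a_def) (simp add: power2_eq_square algebra_simps)
  have s: "s $ i = a * (\<sigma> * b i) - (\<sigma> * T $ 0 * (mink_g i i * axis 0 \<sigma> $ i) + T $ i) / 2" for i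
    by (simp add: s_def s_alg_def inner_ax Hv mink_mat_mult_vector_nth ss flip: T_def)
      (simp add: b_def a_def algebra_simps ss)
  have "s $ 0 = \<sigma> * a\<^sup>2 - T $ 0"
    by (simp add: s g axis_def b_def ss flip: a_def) (simp add: power2_eq_square algebra_simps ss)
  then have s0: "s $ 0 = \<sigma> * S"
    by (simp add: T0 K S_def field_simps)
  \<comment> \<open>The metric terms vanish here, since the covector has no spatial components. Half
    of \<open>a * b i\<close> is cancelled by \<open>T $ i\<close>, and the other terms of
    \<open>T $ i\<close> change sign.\<close>
  have si: "s $ i = (\<sigma> / 2) * (a * b i + Cb i + (q * p0) * p $ i)" if "i \<in> ?I" for i
    using that by (simp add: s T axis_def field_simps)
  have bS: "B = (L2_set b ?I)\<^sup>2" "P = (L2_set (\<lambda>i. p $ i) ?I)\<^sup>2" "F = (sqrt F)\<^sup>2"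
    by (simp_all add: B_def P_def F_def L2_set_def sum_nonneg)
  have amgm: "x * y \<le> (x\<^sup>2 + y\<^sup>2) / 2" for x y :: real
    using sum_squares_bound[of x y] by (simp add: field_simps)
  have "L2_set (\<lambda>i. a * b i + Cb i + (q * p0) * p $ i) ?I
      \<le> L2_set (\<lambda>i. a * b i) ?I + L2_set Cb ?I + L2_set (\<lambda>i. (q * p0) * p $ i) ?I"
    by (rule order.trans[OF L2_set_triangle_ineq add_right_mono[OF L2_set_triangle_ineq]])
  also have "\<dots> \<le> \<bar>a\<bar> * L2_set b ?I + sqrt F * L2_set b ?I + q * (\<bar>p0\<bar> * L2_set (\<lambda>i. p $ i) ?I)"
    using L2_set_matrix_vector_le[of "\<lambda>i j. H $ i $ j" b ?I ?I] \<open>q \<ge> 0\<close>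
    by (simp add: L2_set_mult_left Cb_def[abs_def] F_def abs_mult)
  \<comment> \<open>AM-GM is used once per product. B arises from the first two, which accounts for
    its coefficient 2 in S.\<close>
  also have "\<dots> \<le> (a\<^sup>2 + B) / 2 + (F + B) / 2 + q * ((p0\<^sup>2 + P) / 2)"
    using amgm[of "\<bar>a\<bar>" "L2_set b ?I"] amgm[of "sqrt F" "L2_set b ?I"]
      amgm[of "\<bar>p0\<bar>" "L2_set (\<lambda>i. p $ i) ?I"] \<open>q \<ge> 0\<close>
    by (intro add_mono mult_left_mono) (simp_all flip: bS)
  \<comment> \<open>The slack is \<open>q * (p0\<^sup>2 + P) / 2 + c\<close>.\<close>
  also have "\<dots> \<le> 2 * S"
    using \<open>q \<ge> 0\<close> \<open>c \<ge> 0\<close> by (simp add: S_def field_simps P_def sum_nonneg)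
  finally have le: "L2_set (\<lambda>i. a * b i + Cb i + (q * p0) * p $ i) ?I \<le> 2 * S" .
  have "(\<Sum>i\<in>?I. (s $ i)\<^sup>2) = (\<Sum>i\<in>?I. (a * b i + Cb i + (q * p0) * p $ i)\<^sup>2 / 4)"
    by (rule sum.cong) (simp_all only: si power_mult_distrib power_divide \<sigma>, simp)
  also have "\<dots> = (L2_set (\<lambda>i. a * b i + Cb i + (q * p0) * p $ i) ?I)\<^sup>2 / 4"
    by (simp add: L2_set_def sum_nonneg sum_divide_distrib)
  also have "\<dots> \<le> (2 * S)\<^sup>2 / 4"
    by (intro divide_right_mono power_mono le) (simp_all add: L2_set_nonneg)
  also have "\<dots> = (s $ 0)\<^sup>2"
    by (simp add: s0 power_mult_distrib \<sigma>)
  finally have "(\<Sum>i\<in>?I. (s $ i)\<^sup>2) \<le> (s $ 0)\<^sup>2" .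
  moreover have "s \<bullet> (mink_mat *v s) = (s $ 0)\<^sup>2 - (\<Sum>i\<in>?I. (s $ i)\<^sup>2)"
    by (simp add: inner_vec_def mink_mat_mult_vector_nth sum_4_split g sum_negf
        power2_eq_square cong: sum.cong_simp)
  ultimately show ?thesis by simp
qed

section \<open>Reduction to the rest frame\<close>

lemma s_alg_causal:
  fixes p :: "real^4"
  assumes "q \<ge> 0" "c \<ge> 0" and sym: "transpose H = H" and v: "v \<bullet> (mink_mat *v v) = 1"
  defines "s \<equiv> s_alg q c H p v"
  shows "s \<bullet> (mink_mat *v s) \<ge> 0"
proof -
  \<comment> \<open>The sign \<open>e\<close> keeps \<open>1 + e * v $ 0\<close>, hence the norm of \<open>n\<close>, away from 0.\<close>
  define e where "e = (if v $ 0 \<ge> 0 then 1 else -1 :: real)"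
  \<comment> \<open>\<open>mink_mat *v n\<close> is v minus \<open>axis 0 (- e)\<close>. Both of
    these have Minkowski square 1, so the reflection along their difference exchanges them.\<close>
  define n where "n = mink_mat *v v + axis 0 e"
  define k where "k = 1 / (1 + e * v $ 0)"
  have ee: "e * e = 1" by (simp add: e_def)
  have pos: "1 + e * v $ 0 > 0" by (simp add: e_def)
  have ax: "mink_mat *v axis 0 e = axis 0 e"
    by (simp add: vec_eq_iff mink_mat_mult_vector_nth axis_def mink_g_def)
  have \<eta>n: "mink_mat *v n = v + axis 0 e"
    by (simp add: n_def matrix_vector_right_distrib mink_mat_involution ax)
  have \<eta>v0: "(mink_mat *v v) $ 0 = v $ 0"
    by (simp add: mink_mat_mult_vector_nth mink_g_def)
  have nv: "n \<bullet> v = 1 + e * v $ 0"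
    using v by (simp add: n_def inner_add_left mink_mat_self_adjoint inner_axis')
  moreover have "n \<bullet> axis 0 e = 1 + e * v $ 0"
    by (simp add: n_def inner_axis \<eta>v0 ee inner_add_left inner_axis_axis algebra_simps)
  ultimately have "n \<bullet> (mink_mat *v n) = 2 * (1 + e * v $ 0)"
    by (simp add: \<eta>n inner_add_right)
  then have k: "k * (n \<bullet> (mink_mat *v n)) = 2"
    using pos by (simp add: k_def field_simps)
  define M where "M = ((\<chi> i j. (if i = j then 1 else 0) - k * (mink_mat *v n) $ i * n $ j) :: real^4^4)"
  note M = Lorentz_reflection[OF k, folded M_def]
  have "M *v v = axis 0 (- e)"
    using pos by (simp add: M(1) nv k_def \<eta>n vec_eq_iff axis_def)
  then have Mv: "M *v axis 0 (- e) = v"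
    by (metis M(2))
  \<comment> \<open>The transpose enters because \<open>s_alg_Lorentz\<close> pulls covectors back
    by \<open>transpose L\<close>, which has to be the map M taking the time axis to v.\<close>
  define L where "L = transpose M"
  have L: "L ** mink_mat ** transpose L = mink_mat" "transpose L ** mink_mat ** L = mink_mat"
    using M(3,4) by (simp_all add: L_def)
  have "s_alg q c (L ** H ** transpose L) (L *v p) (axis 0 (- e)) = L *v s"
    unfolding s_def s_alg_Lorentz[OF L] by (simp only: L_def transpose_transpose Mv)
  moreover have "transpose (L ** H ** transpose L) = L ** H ** transpose L"
    by (simp only: matrix_transpose_mul transpose_transpose sym matrix_mul_assoc)
  ultimately have "(L *v s) \<bullet> (mink_mat *v (L *v s)) \<ge> 0"
    using s_alg_rest_frame[of q c "L ** H ** transpose L" "- e" "L *v p"] assms(1,2) ee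
    by (simp add: power2_eq_square)
  also have "(L *v s) \<bullet> (mink_mat *v (L *v s)) = s \<bullet> (transpose L *v (mink_mat *v (L *v s)))"
    using inner_transpose[of "transpose L" s "mink_mat *v (L *v s)"] by (simp only: transpose_transpose)
  also have "\<dots> = s \<bullet> (mink_mat *v s)"
    by (simp only: L(2) matrix_vector_mul_assoc matrix_mul_assoc)
  finally show ?thesis .
qed

section \<open>Contraction of the index expressions\<close>

lemma contract3:
  fixes X v :: "4 \<Rightarrow> real"
  shows "(\<Sum>\<beta>\<in>UNIV. \<Sum>\<gamma>\<in>UNIV. \<Sum>\<delta>\<in>UNIV. X \<beta> * Y \<gamma> \<delta> * v \<beta> * v \<gamma> * v \<delta>)
      = (\<Sum>\<beta>\<in>UNIV. X \<beta> * v \<beta>) * (\<Sum>\<gamma>\<in>UNIV. \<Sum>\<delta>\<in>UNIV. Y \<gamma> \<delta> * v \<gamma> * v \<delta>)" (is ?A)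
    and "(\<Sum>\<beta>\<in>UNIV. \<Sum>\<gamma>\<in>UNIV. \<Sum>\<delta>\<in>UNIV. X \<gamma> * Y \<beta> \<delta> * v \<beta> * v \<gamma> * v \<delta>)
      = (\<Sum>\<beta>\<in>UNIV. X \<beta> * v \<beta>) * (\<Sum>\<gamma>\<in>UNIV. \<Sum>\<delta>\<in>UNIV. Y \<gamma> \<delta> * v \<gamma> * v \<delta>)" (is ?B)
    and "(\<Sum>\<beta>\<in>UNIV. \<Sum>\<gamma>\<in>UNIV. \<Sum>\<delta>\<in>UNIV. X \<delta> * Y \<beta> \<gamma> * v \<beta> * v \<gamma> * v \<delta>)
      = (\<Sum>\<beta>\<in>UNIV. X \<beta> * v \<beta>) * (\<Sum>\<gamma>\<in>UNIV. \<Sum>\<delta>\<in>UNIV. Y \<gamma> \<delta> * v \<gamma> * v \<delta>)" (is ?C)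
proof -
  show A: ?A
    unfolding sum_distrib_right unfolding sum_distrib_left by (simp add: mult_ac)
  show B: ?B
    unfolding A[symmetric] by (subst sum.swap) (simp add: mult_ac)
  have "(\<Sum>\<gamma>\<in>UNIV. \<Sum>\<delta>\<in>UNIV. X \<delta> * Y \<beta> \<gamma> * v \<beta> * v \<gamma> * v \<delta>)
      = (\<Sum>\<gamma>\<in>UNIV. \<Sum>\<delta>\<in>UNIV. X \<gamma> * Y \<beta> \<delta> * v \<beta> * v \<gamma> * v \<delta>)" for \<beta>
    by (subst sum.swap) (simp add: mult_ac)
  then show ?C by (simp only: B)
qed

text \<open>Contracted three times with the same v, a product depends only on which factor carries
  the free index. The three products of A coincide, and the six products of metric and T fall into
  two groups of three, so the weights 1/3 and 1/6 become 1 and 1/2.\<close>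

lemma W_contraction:
  fixes A T :: "4 \<Rightarrow> 4 \<Rightarrow> real" and v :: "4 \<Rightarrow> real"
  assumes A: "\<And>i j. A i j = A j i" and T: "\<And>i j. T i j = T j i"
  defines "lin \<equiv> \<lambda>X. \<Sum>\<beta>\<in>UNIV. X \<beta> * v \<beta>"
    and "quad \<equiv> \<lambda>Y. \<Sum>\<gamma>\<in>UNIV. \<Sum>\<delta>\<in>UNIV. Y \<gamma> \<delta> * v \<gamma> * v \<delta>"
  shows "(\<Sum>\<beta>\<in>UNIV. \<Sum>\<gamma>\<in>UNIV. \<Sum>\<delta>\<in>UNIV.
      (1/3 * (A \<alpha> \<beta> * A \<gamma> \<delta> + 2 * symz (\<lambda>c d. A \<alpha> c * A d \<beta>) \<gamma> \<delta>)
       - 1/6 * (mink_g \<alpha> \<beta> * T \<gamma> \<delta> + mink_g \<gamma> \<delta> * T \<alpha> \<beta>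
              + 2 * symz (\<lambda>c d. mink_g \<alpha> c * T d \<beta>) \<gamma> \<delta>
              + 2 * symz (\<lambda>c d. mink_g \<beta> c * T d \<alpha>) \<gamma> \<delta>)) * v \<beta> * v \<gamma> * v \<delta>)
    = lin (A \<alpha>) * quad A
      - 1/2 * (lin (mink_g \<alpha>) * quad T + lin (T \<alpha>) * quad mink_g)"
proof -
  have "(1/3 * (A \<alpha> \<beta> * A \<gamma> \<delta> + 2 * symz (\<lambda>c d. A \<alpha> c * A d \<beta>) \<gamma> \<delta>)
       - 1/6 * (mink_g \<alpha> \<beta> * T \<gamma> \<delta> + mink_g \<gamma> \<delta> * T \<alpha> \<beta>
              + 2 * symz (\<lambda>c d. mink_g \<alpha> c * T d \<beta>) \<gamma> \<delta>
              + 2 * symz (\<lambda>c d. mink_g \<beta> c * T d \<alpha>) \<gamma> \<delta>)) * v \<beta> * v \<gamma> * v \<delta>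
    = 1/3 * (A \<alpha> \<beta> * A \<gamma> \<delta> * v \<beta> * v \<gamma> * v \<delta>) + 1/3 * (A \<alpha> \<gamma> * A \<beta> \<delta> * v \<beta> * v \<gamma> * v \<delta>)
      + 1/3 * (A \<alpha> \<delta> * A \<beta> \<gamma> * v \<beta> * v \<gamma> * v \<delta>)
      - 1/6 * (mink_g \<alpha> \<beta> * T \<gamma> \<delta> * v \<beta> * v \<gamma> * v \<delta>)
      - 1/6 * (mink_g \<alpha> \<gamma> * T \<beta> \<delta> * v \<beta> * v \<gamma> * v \<delta>)
      - 1/6 * (mink_g \<alpha> \<delta> * T \<beta> \<gamma> * v \<beta> * v \<gamma> * v \<delta>)
      - 1/6 * (T \<alpha> \<beta> * mink_g \<gamma> \<delta> * v \<beta> * v \<gamma> * v \<delta>)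
      - 1/6 * (T \<alpha> \<gamma> * mink_g \<beta> \<delta> * v \<beta> * v \<gamma> * v \<delta>)
      - 1/6 * (T \<alpha> \<delta> * mink_g \<beta> \<gamma> * v \<beta> * v \<gamma> * v \<delta>)" for \<beta> \<gamma> \<delta>
    by (simp add: symz_def A[of \<delta> \<beta>] A[of \<gamma> \<beta>] T[of \<delta> \<beta>] T[of \<gamma> \<beta>]
        T[of \<delta> \<alpha>] T[of \<gamma> \<alpha>] field_simps)
  then show ?thesis
    by (simp only: sum.distrib sum_subtractf sum_distrib_left[symmetric] contract3 lin_def quad_def)
      (simp add: algebra_simps)
qed

text \<open>Equality of mixed partials makes the Hessian symmetric, as \<open>W_contraction\<close>
  demands. The unit norm of u turns the contraction of the metric with \<open>lower u\<close> into
  1, so the last term of \<open>s_alg\<close> carries no such factor.\<close>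

lemma supermomentum_eq_s_alg:
  fixes \<phi> :: "real^4 \<Rightarrow> real" and x :: "real^4"
  assumes "C2_field \<phi>" and u: "timelike_unit u"
  defines "H \<equiv> (\<chi> i j. D_uu \<phi> x i j) :: real^4^4" and "p \<equiv> (\<chi> i. D_u \<phi> x i)"
  shows "supermomentum m \<phi> x u = s_alg (m\<^sup>2) (1/2 * m^4 * (\<phi> x)\<^sup>2) H p (lower u)"
    and "transpose H = H"
proof -
  define v where "v = lower u"
  \<comment> \<open>The metric is diagonal, so moving an index only multiplies by a sign; this lets
    every derivative be expressed through \<open>D_uu\<close>.\<close>
  have gs: "(\<Sum>\<mu>\<in>UNIV. mink_g \<alpha> \<mu> * f \<mu>) = mink_g \<alpha> \<alpha> * f \<alpha>" for f :: "4 \<Rightarrow> real" and \<alpha>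
    using mink_mat_mult_vector_nth[of "\<chi> i. f i" \<alpha>]
    by (simp add: mink_mat_def matrix_vector_mult_def)
  have gg: "mink_g i i * mink_g i i = 1" "mink_g i i * (mink_g i i * t) = t" for i t
    by (simp_all add: mink_g_def)
  have D_dd: "D_dd \<phi> x i j = D_dd \<phi> x j i" for i j
    unfolding D_dd_def by (rule pd_commute) fact
  have D_u: "D_u \<phi> x i = mink_g i i * pd i \<phi> x" for i
    by (simp add: D_u_def gs)
  have D_uu: "D_uu \<phi> x i j = mink_g i i * mink_g j j * D_dd \<phi> x i j" for i j
    by (simp add: D_uu_def gs mult.assoc flip: sum_distrib_left)
  have D_ud: "D_ud \<phi> x i j = mink_g j j * D_uu \<phi> x i j" for i j
    by (simp add: D_ud_def gs D_uu gg mult_ac)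
  have A: "D_uu \<phi> x i j = D_uu \<phi> x j i" for i j
    by (simp add: D_uu D_dd[of i] mult_ac)
  then show H: "transpose H = H"
    by (simp add: H_def transpose_def vec_eq_iff)
  have T: "tau m \<phi> x i j = tau m \<phi> x j i" for i j
    by (simp add: tau_def D_ud mink_g_commute[of i] mult_ac)
  have "trace (H ** mink_mat ** transpose H ** mink_mat)
      = (\<Sum>\<rho>\<in>UNIV. \<Sum>\<sigma>\<in>UNIV. D_uu \<phi> x \<rho> \<sigma> * D_dd \<phi> x \<rho> \<sigma>)"
    unfolding trace_Minkowski_square by (simp add: H_def D_uu power2_eq_square gg mult_ac)
  moreover have "p \<bullet> (mink_mat *v p) = (\<Sum>\<kappa>\<in>UNIV. D_u \<phi> x \<kappa> * pd \<kappa> \<phi> x)"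
    by (simp add: inner_vec_def mink_mat_mult_vector_nth p_def D_u gg mult_ac)
  ultimately have K: "K_scalar m \<phi> x = K_alg (m\<^sup>2) (1/2 * m^4 * (\<phi> x)\<^sup>2) H p"
    by (simp add: K_scalar_def K_alg_def)
  have \<eta>v: "(mink_mat *v v) $ \<alpha> = (\<Sum>\<beta>\<in>UNIV. mink_g \<alpha> \<beta> * v $ \<beta>)" for \<alpha>
    by (simp add: mink_mat_def matrix_vector_mult_def)
  have lin_tau: "(\<Sum>\<beta>\<in>UNIV. tau m \<phi> x \<alpha> \<beta> * v $ \<beta>)
      = tau_alg (m\<^sup>2) (1/2 * m^4 * (\<phi> x)\<^sup>2) H p v $ \<alpha>" for \<alpha>
  proof -
    have "tau m \<phi> x \<alpha> \<beta> * v $ \<beta>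
        = (\<Sum>\<kappa>\<in>UNIV. H $ \<alpha> $ \<kappa> * (mink_g \<kappa> \<kappa> * (H $ \<beta> $ \<kappa> * v $ \<beta>)))
          - (m\<^sup>2 * p $ \<alpha>) * (p $ \<beta> * v $ \<beta>)
          - (1/2 * K_scalar m \<phi> x) * (mink_g \<alpha> \<beta> * v $ \<beta>)" for \<beta>
      by (simp add: tau_def D_ud H_def p_def sum_distrib_left algebra_simps)
    then have "(\<Sum>\<beta>\<in>UNIV. tau m \<phi> x \<alpha> \<beta> * v $ \<beta>)
        = (\<Sum>\<beta>\<in>UNIV. \<Sum>\<kappa>\<in>UNIV. H $ \<alpha> $ \<kappa> * (mink_g \<kappa> \<kappa> * (H $ \<beta> $ \<kappa> * v $ \<beta>)))
          - (m\<^sup>2 * (p \<bullet> v)) * p $ \<alpha> - (1/2 * K_scalar m \<phi> x) * (mink_mat *v v) $ \<alpha>"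
      by (simp only: sum_subtractf \<eta>v inner_vec_def sum_distrib_left[symmetric]) simp
    also have "(\<Sum>\<beta>\<in>UNIV. \<Sum>\<kappa>\<in>UNIV. H $ \<alpha> $ \<kappa> * (mink_g \<kappa> \<kappa> * (H $ \<beta> $ \<kappa> * v $ \<beta>)))
        = (\<Sum>\<kappa>\<in>UNIV. \<Sum>\<beta>\<in>UNIV. H $ \<alpha> $ \<kappa> * (mink_g \<kappa> \<kappa> * (H $ \<beta> $ \<kappa> * v $ \<beta>)))"
      by (rule sum.swap)
    also have "\<dots> = (H *v (mink_mat *v (transpose H *v v))) $ \<alpha>"
      by (simp add: matrix_vector_mult_def[of H "mink_mat *v _"] mink_mat_mult_vector_nth
          matrix_vector_mult_def[of "\<chi> i j. H $ j $ i"] transpose_def sum_distrib_left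
          del: transpose_matrix_vector)
    finally show ?thesis by (simp add: tau_alg_def K del: transpose_matrix_vector)
  qed
  have lin_H: "(\<Sum>\<beta>\<in>UNIV. D_uu \<phi> x \<alpha> \<beta> * v $ \<beta>) = (H *v v) $ \<alpha>" for \<alpha>
    by (simp add: H_def matrix_vector_mult_def)
  have quad: "(\<Sum>\<gamma>\<in>UNIV. \<Sum>\<delta>\<in>UNIV. Y \<gamma> \<delta> * v $ \<gamma> * v $ \<delta>)
      = (\<Sum>\<gamma>\<in>UNIV. v $ \<gamma> * (\<Sum>\<delta>\<in>UNIV. Y \<gamma> \<delta> * v $ \<delta>))" for Y :: "4 \<Rightarrow> 4 \<Rightarrow> real"
    by (simp add: sum_distrib_left mult_ac)
  have "v \<bullet> (mink_mat *v v) = 1"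
    using u by (simp add: v_def timelike_unit_def mink_prod_eq_inner lower_eq_mink_mat
        mink_mat_involution mink_mat_self_adjoint)
  then have "(\<Sum>\<gamma>\<in>UNIV. v $ \<gamma> * (mink_mat *v v) $ \<gamma>) = 1"
    by (simp add: inner_vec_def)
  then show "supermomentum m \<phi> x u = s_alg (m\<^sup>2) (1/2 * m^4 * (\<phi> x)\<^sup>2) H p (lower u)"
    unfolding supermomentum_def W_def v_def[symmetric]
    by (simp only: W_contraction[where A = "D_uu \<phi> x" and T = "tau m \<phi> x" and v = "\<lambda>i. v $ i", OF A T])
      (simp only: quad lin_H lin_tau \<eta>v[symmetric],
        simp add: s_alg_def vec_eq_iff inner_vec_def mult_ac)
qed

theorem theorem5:
  fixes m :: real and \<phi> :: "real^4 \<Rightarrow> real" and x u :: "real^4"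
  assumes "m \<ge> 0"
    and "C2_field \<phi>"
    and "\<And>y. dalembertian \<phi> y + m^2 * \<phi> y = 0"
    and "timelike_unit u"
  shows "(\<Sum>\<alpha>\<in>UNIV. supermomentum m \<phi> x u $ \<alpha> * lower (supermomentum m \<phi> x u) $ \<alpha>) \<ge> 0"
proof -
  have "lower u \<bullet> (mink_mat *v lower u) = 1"
    using assms(4) by (simp add: timelike_unit_def mink_prod_eq_inner lower_eq_mink_mat
        mink_mat_involution mink_mat_self_adjoint)
  then have "supermomentum m \<phi> x u \<bullet> (mink_mat *v supermomentum m \<phi> x u) \<ge> 0"
    unfolding supermomentum_eq_s_alg(1)[OF assms(2,4)]
    by (intro s_alg_causal supermomentum_eq_s_alg(2)[OF assms(2,4)]) simp_all
  then show ?thesis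
    by (simp add: inner_vec_def lower_eq_mink_mat)
qed

end
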